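(* Suppose $\psi$ is an embedding from edit distance on $\Sigma^n$ into Hamming space with subpolynomial distortion $\gamma(n)$ (with $\gamma(n)\ge2$ for all $n$), i.e., there is $T\ge1$ such that $\Delta_{\text{ed}}(x,y)\le\frac1T\operatorname{Ham}(\psi(x),\psi(y))\le\gamma(n)\Delta_{\text{ed}}(x,y)$ for all $x,y\in\Sigma^n$. Let $K\in\mathbb{N}$ and pick some $D\in\operatorname{poly}(K)$. Then there exist $R\in O(K^3)$ and a randomized embedding $\alpha:\Sigma^n\to\{0,1\}$ such that for all $(D,R)$-periodic free $x,y\in\Sigma^n$ with $\Delta_{\text{ed}}(x,y)\le K$, $$\frac{1}{\gamma(O(K^3D))}\,\Omega(\Delta_{\text{ed}}(x,y))\le K\Pr[\alpha(x)\ne\alpha(y)]\le O(\Delta_{\text{ed}}(x,y)).$$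
   Context: $\Delta_{\text{ed}}$ is edit distance (minimum number of insertions, deletions, substitutions); $\operatorname{Ham}$ counts differing coordinates. Subpolynomial means $\gamma(n)=n^{o(1)}$. A string $w$ is $p$-periodic if $w_i=w_{i+p}$ for all $1\le i\le|w|-p$; it is $(D,R)$-periodic (for $R\le D$) if its length is at least $D$ and it is $p$-periodic for some $p\le R$; it is $(D,R)$-periodic free if it contains no contiguous $(D,R)$-periodic substring. *)

theory Defs
  imports
    "HOL-Probability.Probability"
    "HOL-Library.Landau_Symbols"
    "HOL-Library.Sublist"
begin

definition words :: "'a set \<Rightarrow> nat \<Rightarrow> 'a list set" where
  "words A n = {w. set w \<subseteq> A \<and> length w = n}"

inductive edit_step :: "'a list \<Rightarrow> 'a list \<Rightarrow> bool" where
  insertion: "edit_step (u @ v) (u @ a # v)"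
| deletion: "edit_step (u @ a # v) (u @ v)"
| substitution: "edit_step (u @ a # v) (u @ b # v)"

definition edit_distance :: "'a list \<Rightarrow> 'a list \<Rightarrow> nat" where
  "edit_distance x y = (LEAST k. (edit_step ^^ k) x y)"

(* Only meaningful for lists of equal length. *)
definition hamming :: "'b list \<Rightarrow> 'b list \<Rightarrow> nat" where
  "hamming u v = card {i. i < length u \<and> u ! i \<noteq> v ! i}"

(* The alphabet 'b and the dimension m of the target Hamming space are unrestricted;
   the scaling factor T may depend on n. *)
definition hamming_embedding ::
    "'a set \<Rightarrow> nat \<Rightarrow> real \<Rightarrow> ('a list \<Rightarrow> 'b list) \<Rightarrow> bool" where
  "hamming_embedding A n g \<psi> \<longleftrightarrow>
     (\<exists>m. \<forall>x\<in>words A n. length (\<psi> x) = m) \<and>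
     (\<exists>T\<ge>(1::real). \<forall>x\<in>words A n. \<forall>y\<in>words A n.
        real (edit_distance x y) \<le> 1 / T * real (hamming (\<psi> x) (\<psi> y)) \<and>
        1 / T * real (hamming (\<psi> x) (\<psi> y)) \<le> g * real (edit_distance x y))"

(* \<gamma>(n) = n^{o(1)} *)
definition subpolynomial :: "(nat \<Rightarrow> real) \<Rightarrow> bool" where
  "subpolynomial \<gamma> \<longleftrightarrow>
     (\<exists>e::nat \<Rightarrow> real. e \<longlonglongrightarrow> 0 \<and> (\<forall>\<^sub>F n in sequentially. \<gamma> n = real n powr e n))"

definition poly_bounded :: "(nat \<Rightarrow> nat) \<Rightarrow> bool" where
  "poly_bounded D \<longleftrightarrow> (\<exists>e::nat. (\<lambda>K. real (D K)) \<in> O(\<lambda>K. real K ^ e))"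

definition p_periodic :: "nat \<Rightarrow> 'a list \<Rightarrow> bool" where
  "p_periodic p w \<longleftrightarrow> (\<forall>i. i + p < length w \<longrightarrow> w ! i = w ! (i + p))"

(* Intended for R \<le> D. A period is positive: every list is 0-periodic. *)
definition DR_periodic :: "nat \<Rightarrow> nat \<Rightarrow> 'a list \<Rightarrow> bool" where
  "DR_periodic D R w \<longleftrightarrow> D \<le> length w \<and> (\<exists>p. 1 \<le> p \<and> p \<le> R \<and> p_periodic p w)"

definition DR_periodic_free :: "nat \<Rightarrow> nat \<Rightarrow> 'a list \<Rightarrow> bool" where
  "DR_periodic_free D R w \<longleftrightarrow> \<not> (\<exists>v. sublist v w \<and> DR_periodic D R v)"

end

theory Submission
  imports Defs
begin

text \<open>
  A string is cut into blocks from left to right. After a cut at position \<open>p\<close> a random offset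
  \<open>B\<close> of order \<open>K D\<close> is drawn, and the next cut is the first of the positions
  \<open>p + B, \<dots>, p + B + R - 1\<close> whose length-\<open>2D\<close> window is marked, every possible window being marked
  independently with probability \<open>1/K\<close>. The value of the embedding is the exclusive or of hashes of the
  blocks, where each block is padded, embedded by \<open>\<psi>\<close>, and the coordinates are sampled at a rate that
  scales with \<open>1 / (T \<gamma> K)\<close>.

  The bias \<open>1 - 2 Pr[\<alpha>(x) \<noteq> \<alpha>(y)]\<close> is multiplicative under exclusive or and edit distance is
  subadditive under concatenation, so the lower bound holds for every way of cutting. For the upper
  bound the triangle inequality reduces to a single deletion: transforming \<open>x\<close> into \<open>y\<close> from left to
  right only visits strings made of a prefix of \<open>y\<close> and a suffix of \<open>x\<close>, which are still free of
  periodic substrings of length \<open>2D\<close>. Cuts before the deletion agree. Except with probability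
  \<open>O(1/K)\<close>, no examined window meets the deletion, and then the first cut after it falls at the same
  letter in both strings: this can only fail if the first window is marked or no later one is, and
  the latter is unlikely because the absence of short periods makes the windows distinct.
\<close>

subsection \<open>Edit distance\<close>

lemma edit_step_sym: "edit_step x y \<Longrightarrow> edit_step y x"
  by (induction rule: edit_step.induct) (auto intro: edit_step.intros)

lemma edit_step_append:
  assumes "edit_step x y"
  shows "edit_step (p @ x @ s) (p @ y @ s)"
  using assms
proof (induction rule: edit_step.induct)
  case (insertion u v a)
  show ?case using edit_step.insertion[of "p @ u" "v @ s" a] by simp
next
  case (deletion u a v)
  show ?case using edit_step.deletion[of "p @ u" a "v @ s"] by simp
next
  case (substitution u a v b)
  show ?case using edit_step.substitution[of "p @ u" a "v @ s" b] by simp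
qed

lemma edit_step_rev: "edit_step x y \<Longrightarrow> edit_step (rev x) (rev y)"
  by (induction rule: edit_step.induct) (auto intro: edit_step.intros)

lemma edit_step_Cons: "edit_step x y \<Longrightarrow> edit_step (a # x) (a # y)"
  using edit_step_append[of x y "[a]" "[]"] by simp

lemma edit_step_head:
  "edit_step x (a # x)" "edit_step (a # x) x" "edit_step (a # x) (b # x)"
  using edit_step.intros[of "[]"] by fastforce+

lemma edit_step_NilD: "edit_step [] z \<Longrightarrow> \<exists>a. z = [a]"
  by (auto elim: edit_step.cases)

lemma edit_step_ConsD:
  assumes "edit_step (b # y) z"
  shows "(\<exists>a. z = a # b # y) \<or> z = y \<or> (\<exists>c. z = c # y) \<or> (\<exists>z'. z = b # z' \<and> edit_step y z')"
  using assms
proof cases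
  case (insertion u v a)
  then show ?thesis by (cases u) (auto intro: edit_step.intros)
next
  case (deletion u a v)
  then show ?thesis by (cases u) (auto intro: edit_step.intros)
next
  case (substitution u a v b)
  then show ?thesis by (cases u) (auto intro: edit_step.intros)
qed

text \<open>Deleting all of \<open>x\<close> and then inserting all of \<open>y\<close> is a
  sequence of edits, so the \<open>LEAST\<close> in \<open>edit_distance\<close> is always
  attained.\<close>

lemma relpowp_edit_step_exists: "\<exists>k. (edit_step ^^ k) x y"
proof -
  have to_nil: "edit_step\<^sup>*\<^sup>* x []" for x :: "'a list"
    by (induction x) (auto intro: converse_rtranclp_into_rtranclp edit_step_head)
  have from_nil: "edit_step\<^sup>*\<^sup>* [] y" for y :: "'a list"
    by (induction y) (auto intro: rtranclp.rtrancl_into_rtrancl edit_step_head)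
  show ?thesis
    using rtranclp_trans[OF to_nil from_nil] by (simp add: rtranclp_power)
qed

lemma relpowp_edit_distance: "(edit_step ^^ edit_distance x y) x y"
  unfolding edit_distance_def by (rule LeastI_ex) (rule relpowp_edit_step_exists)

lemma edit_distance_le: "(edit_step ^^ k) x y \<Longrightarrow> edit_distance x y \<le> k"
  unfolding edit_distance_def by (rule Least_le)

lemma edit_distance_self [simp]: "edit_distance x x = 0"
  using edit_distance_le[of 0 x x] by simp

lemma edit_distance_step: "edit_step x y \<Longrightarrow> edit_distance x y \<le> 1"
  by (rule edit_distance_le) auto

lemma edit_distance_triangle: "edit_distance x z \<le> edit_distance x y + edit_distance y z"
  by (rule edit_distance_le) (auto simp: relpowp_add intro: relcomppI relpowp_edit_distance)

lemma edit_distance_commute: "edit_distance x y = edit_distance y x"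
proof -
  have "edit_distance y x \<le> edit_distance x y" for x y :: "'a list"
  proof (rule edit_distance_le)
    have "(edit_step ^^ k) x y \<Longrightarrow> (edit_step ^^ k) y x" for k and x y :: "'a list"
      by (induction k arbitrary: y)
        (auto intro: relpowp_Suc_I2 edit_step_sym elim!: relpowp_Suc_E simp del: relpowp.simps(2))
    then show "(edit_step ^^ edit_distance x y) y x"
      by (simp add: relpowp_edit_distance)
  qed
  then show ?thesis by (simp add: order_antisym)
qed

lemma edit_distance_mono_map:
  assumes "\<And>x y. edit_step x y \<Longrightarrow> edit_step (f x) (f y)"
  shows "edit_distance (f x) (f y) \<le> edit_distance x y"
proof -
  have "(edit_step ^^ k) x y \<Longrightarrow> (edit_step ^^ k) (f x) (f y)" for k
    by (induction k arbitrary: y) (auto intro!: relcomppI dest: assms)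
  then show ?thesis by (simp add: edit_distance_le relpowp_edit_distance)
qed

lemma edit_distance_rev: "edit_distance (rev x) (rev y) = edit_distance x y"
  using edit_distance_mono_map[of rev x y] edit_distance_mono_map[of rev "rev x" "rev y"]
  by (simp add: edit_step_rev)

lemma edit_distance_append:
  "edit_distance (x @ x') (y @ y') \<le> edit_distance x y + edit_distance x' y'"
proof -
  have "edit_distance (x @ x') (y @ x') \<le> edit_distance x y"
    by (rule edit_distance_mono_map) (use edit_step_append[of _ _ "[]"] in simp)
  moreover have "edit_distance (y @ x') (y @ y') \<le> edit_distance x' y'"
    by (rule edit_distance_mono_map) (use edit_step_append[of _ _ _ "[]"] in simp)
  ultimately show ?thesis
    using edit_distance_triangle[of "x @ x'" "y @ y'" "y @ x'"] by linarith
qed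

text \<open>The rule \<open>slack\<close> turns the index into an upper bound on the cost, which removes existential
  quantifiers from the inductions.\<close>

inductive alignment :: "nat \<Rightarrow> 'a list \<Rightarrow> 'a list \<Rightarrow> bool" where
  nil: "alignment 0 [] []"
| slack: "alignment k x y \<Longrightarrow> alignment (Suc k) x y"
| match: "alignment k x y \<Longrightarrow> alignment k (a # x) (a # y)"
| del: "alignment k x y \<Longrightarrow> alignment (Suc k) (a # x) y"
| ins: "alignment k x y \<Longrightarrow> alignment (Suc k) x (b # y)"
| sub: "alignment k x y \<Longrightarrow> alignment (Suc k) (a # x) (b # y)"

section \<open>Alignments as witnesses of edit distance, and cancellation of common letters\<close>

lemma alignment_refl: "alignment 0 x x"
  by (induction x) (auto intro: alignment.intros)

text \<open>The step either hits the letter that the outermost rule accounts for, which changes that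
  rule at cost at most one, or it is passed on to the tails. If it undoes an earlier insertion,
  \<open>slack\<close> absorbs the saved cost.\<close>

lemma alignment_step: "alignment k x y \<Longrightarrow> edit_step y z \<Longrightarrow> alignment (Suc k) x z"
proof (induction arbitrary: z rule: alignment.induct)
  case nil
  then show ?case by (auto dest!: edit_step_NilD intro: alignment.intros)
next
  case (slack k x y)
  then show ?case by (auto intro: alignment.intros)
next
  case (match k x y a)
  from edit_step_ConsD[OF match.prems] match show ?case by (auto intro: alignment.intros)
next
  case (del k x y a)
  then show ?case by (auto intro: alignment.intros)
next
  case (ins k x y b)
  from edit_step_ConsD[OF ins.prems] ins show ?case by (auto intro: alignment.intros)
next
  case (sub k x y a b)
  from edit_step_ConsD[OF sub.prems] sub show ?case by (auto intro: alignment.intros)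
qed

lemma alignment_edit_distance: "alignment (edit_distance x y) x y"
proof -
  have "(edit_step ^^ k) x y \<Longrightarrow> alignment k x y" for k
    by (induction k arbitrary: y) (auto intro: alignment_refl alignment_step)
  then show ?thesis by (simp add: relpowp_edit_distance)
qed

lemma edit_distance_le_alignment: "alignment k x y \<Longrightarrow> edit_distance x y \<le> k"
proof (induction rule: alignment.induct)
  case (match k x y a)
  then show ?case using edit_distance_append[of "[a]" x "[a]" y] by simp
next
  case (del k x y a)
  then show ?case
    using edit_distance_triangle[of "a # x" y x] edit_distance_step[OF edit_step_head(2)[where x = x and a = a]] by simp
next
  case (ins k x y b)
  then show ?case
    using edit_distance_triangle[of x "b # y" y] edit_distance_step[OF edit_step_head(1)[where x = y and a = b]] by simp
next
  case (sub k x y a b)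
  then show ?case
    using edit_distance_append[of "[a]" x "[b]" y] edit_distance_step[OF edit_step_head(3)[where x = "[]" and a = a and b = b]] by simp
qed auto

text \<open>If the heads are not aligned with each other, one of them is deleted or inserted; the
  edit spent on it pays instead for removing the other copy of \<open>a\<close>.\<close>

lemma alignment_Cons_Cons: "alignment k (a # x) (a # y) \<Longrightarrow> edit_distance x y \<le> k"
proof (induction k "a # x" "a # y" rule: alignment.induct)
  case (del k)
  then show ?case
    using edit_distance_triangle[of x y "a # y"] edit_distance_le_alignment[of k x "a # y"]
      edit_distance_step[OF edit_step_head(2)[where x = y and a = a]] by simp
next
  case (ins k)
  then show ?case
    using edit_distance_triangle[of x y "a # x"] edit_distance_le_alignment[of k "a # x" y]
      edit_distance_step[OF edit_step_head(1)[where x = x and a = a]] by simp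
qed (auto dest: edit_distance_le_alignment)

lemma edit_distance_Cons_Cons: "edit_distance (a # x) (a # y) = edit_distance x y"
proof (rule order_antisym)
  show "edit_distance (a # x) (a # y) \<le> edit_distance x y"
    by (rule edit_distance_mono_map) (rule edit_step_Cons)
  show "edit_distance x y \<le> edit_distance (a # x) (a # y)"
    by (rule alignment_Cons_Cons) (rule alignment_edit_distance)
qed

lemma edit_distance_cancel_prefix: "edit_distance (z @ x) (z @ y) = edit_distance x y"
  by (induction z) (simp_all add: edit_distance_Cons_Cons)

lemma edit_distance_cancel_suffix: "edit_distance (x @ z) (y @ z) = edit_distance x y"
proof -
  have "edit_distance (x @ z) (y @ z) = edit_distance (rev (x @ z)) (rev (y @ z))"
    by (rule edit_distance_rev[symmetric])
  also have "\<dots> = edit_distance (rev x) (rev y)"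
    by (simp add: edit_distance_cancel_prefix)
  also have "\<dots> = edit_distance x y"
    by (rule edit_distance_rev)
  finally show ?thesis .
qed

section \<open>Padding to a common length\<close>

lemma edit_distance_replicate: "edit_distance [] (replicate d a) \<le> d"
proof (induction d)
  case (Suc d)
  then show ?case
    using edit_distance_triangle[of "[]" "a # replicate d a" "replicate d a"]
      edit_distance_step[OF edit_step_head(1)[where x = "replicate d a" and a = a]] by simp
qed simp

text \<open>An embedding into Hamming space is given for one fixed length at a time, whereas blocks
  vary in length. By truncated subtraction a list longer than \<open>N\<close> stays
  unchanged.\<close>

definition pad :: "nat \<Rightarrow> 'a \<Rightarrow> 'a list \<Rightarrow> 'a list" where
  "pad N z u = u @ replicate (N - length u) z"

text \<open>The padding shared by both strings is a common suffix and cancels; the extra padding of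
  the shorter one is as long as the difference of the lengths.\<close>

lemma edit_distance_pad:
  assumes "length u \<le> N" "length v \<le> N"
  shows "edit_distance u v
    \<le> edit_distance (pad N z u) (pad N z v) + nat \<bar>int (length u) - int (length v)\<bar>"
proof -
  have le: "edit_distance u v \<le> edit_distance (pad N z u) (pad N z v) + (length v - length u)"
    if "length u \<le> length v" "length v \<le> N" for u v
  proof -
    define k d where "k = N - length v" and "d = length v - length u"
    have u: "pad N z u = u @ replicate k z @ replicate d z"
      using that by (simp add: pad_def k_def d_def flip: replicate_add)
    have v: "pad N z v = v @ replicate k z" by (simp add: pad_def k_def)
    have "edit_distance (u @ replicate k z) (pad N z u) \<le> d"
      using edit_distance_append[of "u @ replicate k z" "[]" "u @ replicate k z" "replicate d z"]
        edit_distance_replicate[of d z] by (simp add: u)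
    then show ?thesis
      using edit_distance_triangle[of "u @ replicate k z" "pad N z v" "pad N z u"]
        edit_distance_cancel_suffix[of u "replicate k z" v] by (simp add: v d_def)
  qed
  show ?thesis
  proof (cases "length u \<le> length v")
    case True
    then have "nat \<bar>int (length u) - int (length v)\<bar> = length v - length u" by linarith
    with le[OF True assms(2)] show ?thesis by simp
  next
    case False
    then have "nat \<bar>int (length u) - int (length v)\<bar> = length u - length v" by linarith
    with le[of v u] False assms(1) show ?thesis by (simp add: edit_distance_commute)
  qed
qed

text \<open>The deletion makes room for one more padding letter, which is one further insertion at
  the end.\<close>

lemma edit_distance_pad_deletion:
  assumes "length (u @ a # v) \<le> N"
  shows "edit_distance (pad N z (u @ a # v)) (pad N z (u @ v)) \<le> 2"
proof -
  define k where "k = N - length (u @ a # v)"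
  have x: "pad N z (u @ a # v) = u @ a # v @ replicate k z" by (simp add: pad_def k_def)
  have "N - length (u @ v) = Suc k" using assms by (simp add: k_def)
  then have y: "pad N z (u @ v) = u @ v @ replicate k z @ [z]"
    by (simp add: pad_def replicate_append_same)
  have "edit_step (u @ a # v @ replicate k z) (u @ v @ replicate k z)"
    by (rule edit_step.deletion)
  moreover have "edit_step (u @ v @ replicate k z) (u @ v @ replicate k z @ [z])"
    using edit_step.insertion[of "u @ v @ replicate k z" "[]" z] by simp
  ultimately have "(edit_step ^^ 2) (pad N z (u @ a # v)) (pad N z (u @ v))"
    unfolding x y by (auto simp: numeral_2_eq_2)
  then show ?thesis by (rule edit_distance_le)
qed

text \<open>An optimal alignment is carried out from left to right, so every string on the way is a
  prefix of \<open>y\<close> followed by a suffix of \<open>x\<close>; these are the strings that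
  \<open>good\<close> has to cover. A substitution is a deletion followed by an insertion, hence the
  factor 2.\<close>

lemma pseudometric_le_edit_distance:
  fixes d :: "'a list \<Rightarrow> 'a list \<Rightarrow> real"
  assumes self: "\<And>x. d x x = 0" and sym: "\<And>x y. d x y = d y x"
    and tri: "\<And>x y z. d x z \<le> d x y + d y z"
    and c: "0 \<le> c"
    and del: "\<And>u a v. good (u @ a # v) \<Longrightarrow> good (u @ v) \<Longrightarrow> d (u @ a # v) (u @ v) \<le> c"
    and good: "\<And>y1 y2 x1 x2. y = y1 @ y2 \<Longrightarrow> x = x1 @ x2 \<Longrightarrow> good (y1 @ x2)"
  shows "d x y \<le> 2 * real (edit_distance x y) * c"
proof -
  \<comment> \<open>Here \<open>w\<close> is the part of the target already produced; carrying it
    along lets the hypothesis on \<open>good\<close> pass to the tails.\<close>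
  have *: "d (w @ x) (w @ y) \<le> 2 * real k * c"
    if "alignment k x y"
      "\<And>y1 y2 x1 x2. y = y1 @ y2 \<Longrightarrow> x = x1 @ x2 \<Longrightarrow> good (w @ y1 @ x2)" for w k x y
    using that
  proof (induction arbitrary: w rule: alignment.induct)
    case nil
    then show ?case by (simp add: self)
  next
    case (slack k x y)
    then have "d (w @ x) (w @ y) \<le> 2 * real k * c" by blast
    then show ?case using c by (simp add: algebra_simps)
  next
    case (match k x y a)
    show ?case
      using match.IH[of "w @ [a]"] match.prems[of "a # _" _ "a # _"] by simp
  next
    case (del k x y a)
    have "d (w @ x) (w @ y) \<le> 2 * real k * c"
      using del.IH[of w] del.prems[of _ _ "a # _"] by simp
    moreover have "d (w @ a # x) (w @ x) \<le> c"
      using del.prems[of "[]" _ "[]"] del.prems[of "[]" _ "[a]"] assms(5)[of w a x] by simp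
    ultimately show ?case using tri[of "w @ a # x" "w @ y" "w @ x"] c by (simp add: algebra_simps)
  next
    case (ins k x y b)
    have "d (w @ b # x) (w @ b # y) \<le> 2 * real k * c"
      using ins.IH[of "w @ [b]"] ins.prems[of "b # _"] by simp
    moreover have "d (w @ x) (w @ b # x) \<le> c"
      using ins.prems[of "[]" _ "[]"] ins.prems[of "[b]" _ "[]"] assms(5)[of w b x]
      by (simp add: sym)
    ultimately show ?case using tri[of "w @ x" "w @ b # y" "w @ b # x"] c by (simp add: algebra_simps)
  next
    case (sub k x y a b)
    have "d (w @ b # x) (w @ b # y) \<le> 2 * real k * c"
      using sub.IH[of "w @ [b]"] sub.prems[of "b # _" _ "a # _"] by simp
    moreover have "d (w @ a # x) (w @ x) \<le> c"
      using sub.prems[of "[]" _ "[]"] sub.prems[of "[]" _ "[a]"] assms(5)[of w a x] by simp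
    moreover have "d (w @ x) (w @ b # x) \<le> c"
      using sub.prems[of "[]" _ "[a]"] sub.prems[of "[b]" _ "[a]"] assms(5)[of w b x]
      by (simp add: sym)
    ultimately show ?case
      using tri[of "w @ a # x" "w @ b # y" "w @ x"] tri[of "w @ x" "w @ b # y" "w @ b # x"]
      by (simp add: algebra_simps)
  qed
  have "d ([] @ x) ([] @ y) \<le> 2 * real (edit_distance x y) * c"
    by (rule *[OF alignment_edit_distance]) (unfold append_Nil, rule good)
  then show ?thesis by simp
qed

subsection \<open>Random hash functions\<close>

lemma prob_bind_pmf:
  "measure_pmf.prob (bind_pmf p F) X = measure_pmf.expectation p (\<lambda>z. measure_pmf.prob (F z) X)"
proof -
  have int: "integrable p (\<lambda>z. measure_pmf.prob (F z) X)"
    by (rule measure_pmf.integrable_const_bound[where B = 1]) auto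
  have "ennreal (measure_pmf.prob (bind_pmf p F) X) = \<integral>\<^sup>+ z. ennreal (measure_pmf.prob (F z) X) \<partial>p"
    unfolding measure_pmf.emeasure_eq_measure[symmetric] by (rule emeasure_bind_pmf)
  also have "\<dots> = ennreal (measure_pmf.expectation p (\<lambda>z. measure_pmf.prob (F z) X))"
    by (rule nn_integral_eq_integral[OF int]) simp
  finally show ?thesis by (simp add: integral_nonneg_AE)
qed

lemma prob_bind_pmf_ge:
  assumes "\<And>z. z \<in> set_pmf p \<Longrightarrow> L \<le> measure_pmf.prob (F z) X"
  shows "L \<le> measure_pmf.prob (bind_pmf p F) X"
proof -
  have "measure_pmf.expectation p (\<lambda>_. L)
      \<le> measure_pmf.expectation p (\<lambda>z. measure_pmf.prob (F z) X)"
    by (rule integral_mono_AE)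
      (auto intro!: measure_pmf.integrable_const_bound[where B = 1] simp: AE_measure_pmf_iff assms)
  then show ?thesis by (simp add: prob_bind_pmf)
qed

text \<open>Outcomes in the exceptional set \<open>S\<close> get the trivial bound 1, so they cost
  only their total probability.\<close>

lemma prob_bind_pmf_le:
  assumes "\<And>z. z \<in> set_pmf p \<Longrightarrow> z \<notin> S \<Longrightarrow> measure_pmf.prob (F z) X \<le> M" and "0 \<le> M"
  shows "measure_pmf.prob (bind_pmf p F) X \<le> M + measure_pmf.prob p S"
proof -
  have "measure_pmf.prob (F z) X \<le> M + indicator S z" if "z \<in> set_pmf p" for z
    using assms that by (cases "z \<in> S") (auto intro: order_trans[OF measure_pmf.prob_le_1])
  then have "measure_pmf.expectation p (\<lambda>z. measure_pmf.prob (F z) X)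
      \<le> measure_pmf.expectation p (\<lambda>z. M + indicator S z)"
    by (intro integral_mono_AE)
      (auto intro!: measure_pmf.integrable_const_bound[where B = 1] Bochner_Integration.integrable_add
        simp: AE_measure_pmf_iff)
  also have "\<dots> = M + measure_pmf.prob p S"
    by (subst Bochner_Integration.integral_add)
      (auto intro!: measure_pmf.integrable_const_bound[where B = 1])
  finally show ?thesis by (simp add: prob_bind_pmf)
qed

section \<open>Disagreement and bias of random Boolean functions\<close>

definition disagree :: "('x \<Rightarrow> bool) pmf \<Rightarrow> 'x \<Rightarrow> 'x \<Rightarrow> real" where
  "disagree p x y = measure_pmf.prob p {f. f x \<noteq> f y}"

text \<open>This is the expected product of the signs of \<open>f x\<close> and \<open>f y\<close>,
  the quantity that multiplies under exclusive or of independent hashes.\<close>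

definition bias :: "('x \<Rightarrow> bool) pmf \<Rightarrow> 'x \<Rightarrow> 'x \<Rightarrow> real" where
  "bias p x y = 1 - 2 * disagree p x y"

lemma disagree_nonneg: "0 \<le> disagree p x y"
  by (simp add: disagree_def)

lemma disagree_self [simp]: "disagree p x x = 0"
  by (simp add: disagree_def)

lemma disagree_commute: "disagree p x y = disagree p y x"
  by (simp add: disagree_def eq_commute)

lemma disagree_triangle: "disagree p x z \<le> disagree p x y + disagree p y z"
proof -
  have "disagree p x z \<le> measure_pmf.prob p ({f. f x \<noteq> f y} \<union> {f. f y \<noteq> f z})"
    unfolding disagree_def by (rule measure_pmf.finite_measure_mono) auto
  also have "\<dots> \<le> disagree p x y + disagree p y z"
    unfolding disagree_def by (rule measure_Un_le) auto
  finally show ?thesis .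
qed

lemma pmf_False: "pmf p False = 1 - pmf p True"
proof -
  have "(\<Sum>b\<in>UNIV. pmf p b) = 1" by (rule sum_pmf_eq_1) auto
  then show ?thesis by (simp add: UNIV_bool)
qed

text \<open>The two hashes are drawn independently, and once for all arguments; \<open>s\<close> and
  \<open>t\<close> select the piece of the argument that each of them reads.\<close>

definition xor_pmf ::
    "('u \<Rightarrow> bool) pmf \<Rightarrow> ('v \<Rightarrow> bool) pmf \<Rightarrow> ('x \<Rightarrow> 'u) \<Rightarrow> ('x \<Rightarrow> 'v) \<Rightarrow> ('x \<Rightarrow> bool) pmf" where
  "xor_pmf p r s t = map_pmf (\<lambda>(g, f) x. g (s x) \<noteq> f (t x)) (pair_pmf p r)"

lemma bias_xor_pmf: "bias (xor_pmf p r s t) x y = bias p (s x) (s y) * bias r (t x) (t y)"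
proof -
  define P where "P = map_pmf (\<lambda>g. g (s x) \<noteq> g (s y)) p"
  define Q where "Q = map_pmf (\<lambda>f. f (t x) \<noteq> f (t y)) r"
  have P: "disagree p (s x) (s y) = pmf P True" and Q: "disagree r (t x) (t y) = pmf Q True"
    by (simp_all add: disagree_def P_def Q_def pmf_map vimage_def)
  have "disagree (xor_pmf p r s t) x y = measure_pmf.prob (pair_pmf p r)
      ((\<lambda>(g, f). (g (s x) \<noteq> g (s y), f (t x) \<noteq> f (t y))) -` {(True, False), (False, True)})"
    unfolding disagree_def xor_pmf_def measure_map_pmf by (intro arg_cong2[where f = measure]) auto
  also have "\<dots> = measure_pmf.prob (pair_pmf P Q) {(True, False), (False, True)}"
    unfolding P_def Q_def map_pair[symmetric] measure_map_pmf ..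
  also have "\<dots> = pmf P True * pmf Q False + pmf P False * pmf Q True"
    by (simp add: measure_measure_pmf_finite pmf_pair)
  finally show ?thesis
    unfolding bias_def P Q pmf_False by (simp add: algebra_simps)
qed

lemma disagree_xor_pmf_le:
  "disagree (xor_pmf p r s t) x y \<le> disagree p (s x) (s y) + disagree r (t x) (t y)"
proof -
  have "disagree (xor_pmf p r s t) x y = disagree p (s x) (s y) + disagree r (t x) (t y)
      - 2 * (disagree p (s x) (s y) * disagree r (t x) (t y))"
    using bias_xor_pmf[of p r s t x y] by (simp add: bias_def algebra_simps)
  then show ?thesis by (simp add: disagree_nonneg)
qed

section \<open>Hashes whose bias decays with Hamming distance\<close>

lemma disagree_random_bits:
  assumes "finite S" "a \<in> S" "b \<in> S" "a \<noteq> b"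
  shows "disagree (Pi_pmf S False (\<lambda>_. bernoulli_pmf (1/2))) a b = 1/2"
proof -
  define h where "h = bernoulli_pmf (1/2)"
  define Q where "Q = Pi_pmf (S - {a}) False (\<lambda>_. h)"
  \<comment> \<open>Splitting off the bit at \<open>a\<close> leaves the bit at \<open>b\<close> in
    an independent family, so the two form a pair of independent fair bits.\<close>
  have "insert a (S - {a}) = S" using assms(2) by blast
  then have bits: "Pi_pmf S False (\<lambda>_. h) = map_pmf (\<lambda>(c, f). f(a := c)) (pair_pmf h Q)"
    using Pi_pmf_insert[of "S - {a}" a False "\<lambda>_. h"] assms(1) unfolding Q_def by simp
  have "(\<lambda>(c, f). f(a := c)) -` {f. f a \<noteq> f b} = (\<lambda>(c, f). (c, f b)) -` {(True, False), (False, True)}"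
    using assms(4) by (auto split: prod.splits)
  then have "disagree (Pi_pmf S False (\<lambda>_. h)) a b
      = measure_pmf.prob (map_pmf (\<lambda>(c, f). (c, f b)) (pair_pmf h Q)) {(True, False), (False, True)}"
    unfolding disagree_def bits measure_map_pmf by (rule arg_cong)
  also have "map_pmf (\<lambda>(c, f). (c, f b)) (pair_pmf h Q) = pair_pmf h h"
    using map_pair[of "\<lambda>c. c" "\<lambda>f. f b" h Q] assms by (simp add: Q_def Pi_pmf_component)
  also have "measure_pmf.prob (pair_pmf h h) {(True, False), (False, True)} = 1/2"
    by (simp add: measure_measure_pmf_finite pmf_pair h_def)
  finally show ?thesis by (simp add: h_def)
qed

text \<open>With probability \<open>1 - s\<close> the coordinate is sampled and its value receives a
  random bit, otherwise the hash is constant. Different values then disagree with probability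
  \<open>(1 - s) / 2\<close>.\<close>

lemma exists_coordinate_hash:
  fixes \<phi> :: "'x \<Rightarrow> 'c"
  assumes "finite X" "0 \<le> s" "s \<le> 1"
  shows "\<exists>\<alpha>. \<forall>x\<in>X. \<forall>y\<in>X. bias \<alpha> x y = (if \<phi> x = \<phi> y then 1 else s)"
proof -
  define bits where "bits = Pi_pmf (\<phi> ` X) False (\<lambda>_. bernoulli_pmf (1/2))"
  define \<alpha> where "\<alpha> = bind_pmf (bernoulli_pmf (1 - s))
    (\<lambda>c. if c then map_pmf (\<lambda>r x. r (\<phi> x)) bits else return_pmf (\<lambda>_. False))"
  have "disagree \<alpha> x y = (if \<phi> x = \<phi> y then 0 else (1 - s) / 2)" if "x \<in> X" "y \<in> X" for x y
  proof -
    have "disagree \<alpha> x y = (1 - s) * disagree bits (\<phi> x) (\<phi> y)"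
      using assms by (simp add: \<alpha>_def disagree_def prob_bind_pmf vimage_def)
    then show ?thesis
      using disagree_random_bits[of "\<phi> ` X" "\<phi> x" "\<phi> y"] assms(1) that by (simp add: bits_def)
  qed
  then have "bias \<alpha> x y = (if \<phi> x = \<phi> y then 1 else s)" if "x \<in> X" "y \<in> X" for x y
    using that by (simp add: bias_def field_simps)
  then show ?thesis by blast
qed

text \<open>In the exclusive or of independent coordinate hashes each differing coordinate
  contributes one factor \<open>s\<close>.\<close>

lemma exists_sampling_hash:
  fixes \<phi> :: "nat \<Rightarrow> 'x \<Rightarrow> 'c"
  assumes "finite X" "0 \<le> s" "s \<le> 1"
  shows "\<exists>\<alpha>. \<forall>x\<in>X. \<forall>y\<in>X. bias \<alpha> x y = s ^ card {i. i < m \<and> \<phi> i x \<noteq> \<phi> i y}"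
proof (induction m)
  case 0
  show ?case by (rule exI[of _ "return_pmf (\<lambda>_. False)"]) (simp add: bias_def disagree_def)
next
  case (Suc m)
  then obtain \<alpha> where \<alpha>: "\<And>x y. x \<in> X \<Longrightarrow> y \<in> X \<Longrightarrow>
    bias \<alpha> x y = s ^ card {i. i < m \<and> \<phi> i x \<noteq> \<phi> i y}" by blast
  obtain \<beta> where \<beta>: "\<And>x y. x \<in> X \<Longrightarrow> y \<in> X \<Longrightarrow> bias \<beta> x y = (if \<phi> m x = \<phi> m y then 1 else s)"
    using exists_coordinate_hash[OF assms, of "\<phi> m"] by blast
  have "bias (xor_pmf \<alpha> \<beta> (\<lambda>x. x) (\<lambda>x. x)) x y = s ^ card {i. i < Suc m \<and> \<phi> i x \<noteq> \<phi> i y}"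
    if "x \<in> X" "y \<in> X" for x y
  proof -
    have "{i. i < Suc m \<and> \<phi> i x \<noteq> \<phi> i y}
        = (if \<phi> m x = \<phi> m y then {} else {m}) \<union> {i. i < m \<and> \<phi> i x \<noteq> \<phi> i y}"
      by (auto simp: less_Suc_eq)
    then show ?thesis by (simp add: bias_xor_pmf \<alpha> \<beta> that)
  qed
  then show ?case by blast
qed

subsection \<open>Content-defined cuts\<close>

definition window :: "nat \<Rightarrow> nat \<Rightarrow> 'a list \<Rightarrow> 'a list" where
  "window W i x = take W (drop i x)"

lemma window_in_words: "set x \<subseteq> A \<Longrightarrow> i + W \<le> length x \<Longrightarrow> window W i x \<in> words A W"
  by (auto simp: window_def words_def dest!: in_set_takeD in_set_dropD)

lemma window_prefix: "i + W \<le> length u \<Longrightarrow> window W i (u @ v) = window W i u"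
  by (simp add: window_def)

lemma window_deletion: "length u \<le> i \<Longrightarrow> window W (Suc i) (u @ a # v) = window W i (u @ v)"
  by (simp add: window_def Suc_diff_le)

lemma DR_periodic_free_sublist: "DR_periodic_free D R w \<Longrightarrow> sublist v w \<Longrightarrow> DR_periodic_free D R v"
  using sublist_order.order_trans unfolding DR_periodic_free_def by blast

text \<open>Equal windows at distance \<open>j - i\<close> would make the stretch from the start of
  the first to the end of the second periodic with period \<open>j - i\<close>.\<close>

lemma window_neq:
  assumes free: "DR_periodic_free W R x" and ij: "i < j" "j \<le> i + R" and len: "j + W \<le> length x"
  shows "window W i x \<noteq> window W j x"
proof
  assume eq: "window W i x = window W j x"
  define v where "v = take (j - i + W) (drop i x)"
  have len_v: "length v = j - i + W" using ij len by (simp add: v_def)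
  have "v ! k = v ! (k + (j - i))" if "k + (j - i) < length v" for k
  proof -
    have "k < W" using that len_v by simp
    then have "window W i x ! k = x ! (i + k)" "window W j x ! k = x ! (j + k)"
      using ij len by (simp_all add: window_def)
    then show ?thesis using eq \<open>k < W\<close> ij len by (simp add: v_def add.commute)
  qed
  then have "DR_periodic W R v"
    unfolding DR_periodic_def p_periodic_def using ij len_v by (intro conjI exI[of _ "j - i"]) auto
  moreover have "sublist v x"
    unfolding v_def by (rule sublist_order.order_trans[OF sublist_take sublist_drop])
  ultimately show False using free by (auto simp: DR_periodic_free_def)
qed

lemma inj_on_window:
  assumes "DR_periodic_free W R x" "B + R + W \<le> length x"
  shows "inj_on (\<lambda>i. window W (B + i) x) {..<R}"
proof (rule inj_onI)
  fix i j assume ij: "i \<in> {..<R}" "j \<in> {..<R}" and eq: "window W (B + i) x = window W (B + j) x"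
  show "i = j"
  proof (rule linorder_cases[of i j])
    assume "i < j"
    then show ?thesis using window_neq[OF assms(1), of "B + i" "B + j"] ij eq assms(2) by auto
  next
    assume "j < i"
    then show ?thesis using window_neq[OF assms(1), of "B + j" "B + i"] ij eq assms(2) by auto
  qed
qed

section \<open>Random marks and the cut rule\<close>

lemma finite_words: "finite A \<Longrightarrow> finite (words A n)"
  unfolding words_def by (rule finite_lists_length_eq)

text \<open>Marks belong to the content of a window, not to its position, so two strings agree on
  the mark of a shared window.\<close>

definition marks :: "'a set \<Rightarrow> nat \<Rightarrow> real \<Rightarrow> ('a list \<Rightarrow> bool) pmf" where
  "marks A W \<rho> = Pi_pmf (words A W) False (\<lambda>_. bernoulli_pmf \<rho>)"

lemma prob_marked:
  assumes "finite A" "0 \<le> \<rho>" "\<rho> \<le> 1" "w \<in> words A W"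
  shows "measure_pmf.prob (marks A W \<rho>) {h. h w} = \<rho>"
proof -
  have "measure_pmf.prob (marks A W \<rho>) {h. h w}
      = measure_pmf.prob (map_pmf (\<lambda>h. h w) (marks A W \<rho>)) {True}"
    by (simp add: vimage_def)
  then show ?thesis
    using assms by (simp add: marks_def Pi_pmf_component finite_words measure_pmf_single)
qed

text \<open>Injectivity makes the windows distinct words, whose marks are independent.\<close>

lemma prob_none_marked:
  assumes "finite A" "0 \<le> \<rho>" "\<rho> \<le> 1" "inj_on w I" "w ` I \<subseteq> words A W"
  shows "measure_pmf.prob (marks A W \<rho>) {h. \<forall>i\<in>I. \<not> h (w i)} = (1 - \<rho>) ^ card I"
proof -
  define Q where "Q = (\<lambda>z. if z \<in> w ` I then {False} else UNIV)"
  have "{h. \<forall>i\<in>I. \<not> h (w i)} = Pi (words A W) Q"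
    using assms(5) by (auto simp: Q_def Pi_iff split: if_splits)
  then have "measure_pmf.prob (marks A W \<rho>) {h. \<forall>i\<in>I. \<not> h (w i)}
      = (\<Prod>z\<in>words A W. measure_pmf.prob (bernoulli_pmf \<rho>) (Q z))"
    unfolding marks_def by (simp only: measure_Pi_pmf_Pi[OF finite_words[OF assms(1)]])
  also have "\<dots> = (\<Prod>z\<in>words A W. if z \<in> w ` I then 1 - \<rho> else 1)"
    using assms by (intro prod.cong) (auto simp: Q_def measure_pmf_single)
  also have "\<dots> = (\<Prod>z\<in>w ` I. 1 - \<rho>)"
    using assms finite_words[OF assms(1)] by (subst prod.If_cases) (auto simp: Int_absorb1)
  finally show ?thesis using assms(4) by (simp add: card_image)
qed

text \<open>The disjunct \<open>R \<le> i\<close> stops the search: without a mark among the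
  \<open>R\<close> candidates the cut is at \<open>B + R\<close>. A string too short for the search
  becomes a single last block.\<close>

definition cut :: "nat \<Rightarrow> nat \<Rightarrow> nat \<Rightarrow> ('a list \<Rightarrow> bool) \<Rightarrow> 'a list \<Rightarrow> nat" where
  "cut R W B h x = (if length x < B + R + W then length x
     else B + (LEAST i. R \<le> i \<or> h (window W (B + i) x)))"

lemma cut_bounds:
  assumes "B + R + W \<le> length x"
  shows "B \<le> cut R W B h x" "cut R W B h x \<le> B + R"
  using assms by (auto simp: cut_def intro: Least_le)

lemma cut_before_edit:
  assumes "B + R + W \<le> length u"
  shows "cut R W B h (u @ s) = cut R W B h u"
proof -
  have "(R \<le> i \<or> h (window W (B + i) (u @ s))) = (R \<le> i \<or> h (window W (B + i) u))" for i
    using assms by (cases "R \<le> i") (simp_all add: window_prefix)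
  then show ?thesis using assms by (simp add: cut_def)
qed

text \<open>Offset \<open>j + 1\<close> in the longer string shows the same window as offset
  \<open>j\<close> in the shorter one. Only the window at offset 0 of the longer string and the last
  candidate of the shorter one lack a partner; the hypotheses make both irrelevant.\<close>

lemma cut_after_edit:
  assumes "length u \<le> B" and len: "B + R + W \<le> length (u @ v)"
    and unmarked: "\<not> h (window W B (u @ a # v))"
    and marked: "0 < i" "i < R" "h (window W (B + i) (u @ a # v))"
  shows "cut R W B h (u @ a # v) = Suc (cut R W B h (u @ v))"
proof -
  let ?m = "\<lambda>i. h (window W (B + i) (u @ v))"
  have shift: "window W (B + Suc j) (u @ a # v) = window W (B + j) (u @ v)" for j
    using window_deletion[of u "B + j" W a v] assms(1) by simp
  obtain i' where i': "i = Suc i'" using marked(1) by (cases i) auto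
  define j where "j = (LEAST j. ?m j)"
  have m: "?m i'" using marked(3) unfolding i' shift .
  have j: "?m j" unfolding j_def using m by (rule LeastI)
  have j_le: "j \<le> k" if "?m k" for k unfolding j_def using that by (rule Least_le)
  have "Suc j < R" using j_le[OF m] marked(2) i' by simp
  have "(LEAST i. R \<le> i \<or> h (window W (B + i) (u @ v))) = j"
    using j j_le \<open>Suc j < R\<close> by (intro Least_equality) auto
  moreover have "(LEAST i. R \<le> i \<or> h (window W (B + i) (u @ a # v))) = Suc j"
  proof (rule Least_equality)
    show "R \<le> Suc j \<or> h (window W (B + Suc j) (u @ a # v))" using j shift by simp
    fix k assume k: "R \<le> k \<or> h (window W (B + k) (u @ a # v))"
    then show "Suc j \<le> k"
      using unmarked shift j_le \<open>Suc j < R\<close> by (cases k) auto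
  qed
  ultimately show ?thesis using len by (simp add: cut_def)
qed

text \<open>Each level draws a fresh cut function, used for both strings, and a fresh block hash.
  The number bounds the count of blocks; the length of the string suffices, since each cut removes
  at least one letter.\<close>

primrec part_hash ::
    "('a list \<Rightarrow> nat) pmf \<Rightarrow> ('a list \<Rightarrow> bool) pmf \<Rightarrow> nat \<Rightarrow> ('a list \<Rightarrow> bool) pmf" where
  "part_hash \<kappa> g 0 = return_pmf (\<lambda>_. False)"
| "part_hash \<kappa> g (Suc m)
    = bind_pmf \<kappa> (\<lambda>c. xor_pmf g (part_hash \<kappa> g m) (\<lambda>x. take (c x) x) (\<lambda>x. drop (c x) x))"

text \<open>For fixed cuts the bounds of the blocks multiply, so the distances of the blocks add up,
  and their sum is at least the distance of the whole strings, however badly the cuts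
  correspond.\<close>

lemma bias_part_hash_le:
  fixes t :: real
  assumes t: "0 \<le> t"
    and g: "\<And>u v. set u \<subseteq> A \<Longrightarrow> set v \<subseteq> A \<Longrightarrow> length u \<le> N \<Longrightarrow> length v \<le> N \<Longrightarrow>
      0 \<le> bias g u v \<and> bias g u v \<le> exp (- t * edit_distance u v)"
    and cut_le: "\<And>c x. c \<in> set_pmf \<kappa> \<Longrightarrow> length (take (c x) x) \<le> N"
    and cut_pos: "\<And>c x. c \<in> set_pmf \<kappa> \<Longrightarrow> x \<noteq> [] \<Longrightarrow> 0 < c x"
    and "set x \<subseteq> A" "set y \<subseteq> A" "length x \<le> m" "length y \<le> m"
  shows "bias (part_hash \<kappa> g m) x y \<le> exp (- t * edit_distance x y)"
  using assms(5-8)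
proof (induction m arbitrary: x y)
  case 0
  then show ?case by (simp add: bias_def disagree_nonneg)
next
  case (Suc m)
  \<comment> \<open>Stated as a lower bound on a probability, the claim passes to the mixture once
    it holds for each cut function.\<close>
  have "(1 - exp (- t * edit_distance x y)) / 2 \<le> disagree (part_hash \<kappa> g (Suc m)) x y"
    unfolding disagree_def part_hash.simps
  proof (rule prob_bind_pmf_ge)
    fix c assume c: "c \<in> set_pmf \<kappa>"
    let ?h = "xor_pmf g (part_hash \<kappa> g m) (\<lambda>x. take (c x) x) (\<lambda>x. drop (c x) x)"
    let ?d1 = "edit_distance (take (c x) x) (take (c y) y)"
    let ?d2 = "edit_distance (drop (c x) x) (drop (c y) y)"
    have sets: "set (take k z) \<subseteq> A" "set (drop k z) \<subseteq> A" if "set z \<subseteq> A" for k z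
      using that set_take_subset[of k z] set_drop_subset[of k z] by auto
    have len: "length (drop (c z) z) \<le> m" if "length z \<le> Suc m" for z
      using cut_pos[OF c, of z] that by (cases "z = []") auto
    have g': "0 \<le> bias g (take (c x) x) (take (c y) y)"
      "bias g (take (c x) x) (take (c y) y) \<le> exp (- t * ?d1)"
      using g[OF sets(1)[OF Suc.prems(1)] sets(1)[OF Suc.prems(2)] cut_le[OF c] cut_le[OF c]] by simp_all
    have IH: "bias (part_hash \<kappa> g m) (drop (c x) x) (drop (c y) y) \<le> exp (- t * ?d2)"
      by (rule Suc.IH[OF sets(2)[OF Suc.prems(1)] sets(2)[OF Suc.prems(2)]
            len[OF Suc.prems(3)] len[OF Suc.prems(4)]])
    have "bias ?h x y \<le> bias g (take (c x) x) (take (c y) y) * exp (- t * ?d2)"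
      unfolding bias_xor_pmf by (rule mult_left_mono[OF IH g'(1)])
    also have "\<dots> \<le> exp (- t * ?d1) * exp (- t * ?d2)"
      by (rule mult_right_mono[OF g'(2)]) simp
    also have "\<dots> = exp (- t * real (?d1 + ?d2))"
      by (simp add: algebra_simps flip: exp_add)
    also have "\<dots> \<le> exp (- t * edit_distance x y)"
      using edit_distance_append[of "take (c x) x" "drop (c x) x" "take (c y) y" "drop (c y) y"] t
      by (simp add: mult_left_mono)
    finally show "(1 - exp (- t * edit_distance x y)) / 2 \<le> measure_pmf.prob ?h {f. f x \<noteq> f y}"
      by (simp add: bias_def disagree_def)
  qed
  then show ?case by (simp add: bias_def)
qed

section \<open>Random cuts and the effect of one deletion\<close>

definition cuts :: "'a set \<Rightarrow> nat \<Rightarrow> nat \<Rightarrow> real \<Rightarrow> nat \<Rightarrow> ('a list \<Rightarrow> nat) pmf" where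
  "cuts A R W \<rho> B0 = bind_pmf (pmf_of_set {B0..<2 * B0}) (\<lambda>B. map_pmf (cut R W B) (marks A W \<rho>))"

lemma cuts_cases:
  assumes "c \<in> set_pmf (cuts A R W \<rho> B0)" "0 < B0"
  obtains B h where "B0 \<le> B" "B < 2 * B0" "c = cut R W B h"
  using assms by (auto simp: cuts_def)

lemma length_take_cuts:
  assumes "c \<in> set_pmf (cuts A R W \<rho> B0)" "0 < B0"
  shows "length (take (c x) x) \<le> 2 * B0 + R + W"
proof -
  obtain B h where B: "B0 \<le> B" "B < 2 * B0" "c = cut R W B h" using assms by (rule cuts_cases)
  show ?thesis
    using B cut_bounds(2)[of B R W x h] by (cases "B + R + W \<le> length x") (auto simp: cut_def)
qed

lemma cuts_pos:
  assumes "c \<in> set_pmf (cuts A R W \<rho> B0)" "0 < B0" "x \<noteq> []"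
  shows "0 < c x"
proof -
  obtain B h where B: "B0 \<le> B" "B < 2 * B0" "c = cut R W B h" using assms(1,2) by (rule cuts_cases)
  show ?thesis using B assms(2,3) by (auto simp: cut_def)
qed

text \<open>At most \<open>R + W\<close> offsets let the scanned range contain position
  \<open>e\<close>, and at most one puts its end exactly at \<open>l\<close>.\<close>

lemma prob_offset_hits_edit:
  assumes "0 < B0"
  shows "measure_pmf.prob (pmf_of_set {B0..<2 * B0}) ({B. B \<le> e \<and> e < B + R + W} \<union> {B. l = B + R + W})
    \<le> real (R + W + 1) / real B0"
proof -
  let ?S = "{B. B \<le> e \<and> e < B + R + W} \<union> {B. l = B + R + W}"
  have "?S \<subseteq> {Suc e - (R + W)..e} \<union> {l - (R + W)}" by auto
  then have "card ({B0..<2 * B0} \<inter> ?S) \<le> card ({Suc e - (R + W)..e} \<union> {l - (R + W)})"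
    by (intro card_mono) auto
  also have "\<dots> \<le> card {Suc e - (R + W)..e} + card {l - (R + W)}"
    by (rule card_Un_le)
  also have "\<dots> \<le> R + W + 1" by simp
  finally show ?thesis
    using assms by (simp add: measure_pmf_of_set divide_right_mono)
qed

text \<open>Each cut moves the deleted letter at least \<open>B0\<close> closer to the front, and only the last three
  cuts before it, starting at distance less than \<open>3 * B0\<close>, can have a window that meets it; the minimum in
  the bound counts these remaining chances.\<close>

lemma disagree_part_hash_deletion:
  fixes A :: "'a set" and \<rho> G :: real and R W B0 :: nat
  defines "\<kappa> \<equiv> cuts A R W \<rho> B0" and "\<beta> \<equiv> real (R + W + 1) / real B0"
    and "\<eta> \<equiv> \<rho> + (1 - \<rho>) ^ (R - 1)"
  assumes A: "finite A" and \<rho>: "0 \<le> \<rho>" "\<rho> \<le> 1" and B0: "0 < B0" "R + W \<le> B0" and R: "0 < R"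
    and G: "0 \<le> G"
    and g: "\<And>u a v. set (u @ a # v) \<subseteq> A \<Longrightarrow> length (u @ a # v) \<le> 2 * B0 + R + W \<Longrightarrow>
      disagree g (u @ a # v) (u @ v) \<le> G"
    and x: "set (u @ a # v) \<subseteq> A" "DR_periodic_free W R (u @ a # v)"
  shows "disagree (part_hash \<kappa> g m) (u @ a # v) (u @ v)
    \<le> G + \<eta> + \<beta> * (1 + min 2 (length u div B0))"
  using x
proof (induction m arbitrary: u a v)
  case 0
  then show ?case using G \<rho> by (simp add: disagree_def \<eta>_def \<beta>_def)
next
  case (Suc m)
  define x y e where "x = u @ a # v" and "y = u @ v" and "e = length u"
  define F where "F c = xor_pmf g (part_hash \<kappa> g m) (\<lambda>x. take (c x) x) (\<lambda>x. drop (c x) x)" for c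
  \<comment> \<open>Either the scanned range meets the deleted letter, or \<open>x\<close> is just
    long enough to be searched while \<open>y\<close>, one letter shorter, is not.\<close>
  define bad where "bad = {B. B \<le> e \<and> e < B + R + W} \<union> {B. length x = B + R + W}"
  \<comment> \<open>The bound for an offset outside \<open>bad\<close>: a cut before the edit leaves
    the deletion at distance at most \<open>e - B0\<close>, and for \<open>e < B0\<close> no such
    cut exists.\<close>
  define M where "M = G + \<eta> + (if e < B0 then 0 else \<beta> * (1 + min 2 ((e - B0) div B0)))"
  have \<eta>: "0 \<le> \<eta>" and \<beta>: "0 \<le> \<beta>" using \<rho> by (simp_all add: \<eta>_def \<beta>_def)
  have M_ge: "G + \<eta> \<le> M" using \<beta> by (simp add: M_def)
  have len: "length x = Suc (length y)" by (simp add: x_def y_def)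
  have inner: "measure_pmf.prob (bind_pmf (marks A W \<rho>) (\<lambda>h. F (cut R W B h))) {f. f x \<noteq> f y} \<le> M"
    if B: "B0 \<le> B" "B < 2 * B0" "B \<notin> bad" for B
  proof (cases "B \<le> e")
    case True
    then have before: "B + R + W \<le> length u" using B(3) by (simp add: bad_def e_def)
    have "measure_pmf.prob (F (cut R W B h)) {f. f x \<noteq> f y} \<le> M" for h
    proof -
      define c where "c = cut R W B h u"
      have c: "cut R W B h x = c" "cut R W B h y = c"
        using cut_before_edit[OF before] by (simp_all add: x_def y_def c_def)
      have cB: "B \<le> c" "c \<le> length u" using cut_bounds[OF before, of h] before by (simp_all add: c_def)
      have "disagree (F (cut R W B h)) x y
          \<le> disagree g (take c x) (take c y) + disagree (part_hash \<kappa> g m) (drop c x) (drop c y)"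
        unfolding F_def
        using disagree_xor_pmf_le[of g "part_hash \<kappa> g m" "\<lambda>x. take (cut R W B h x) x" "\<lambda>x. drop (cut R W B h x) x" x y]
        unfolding c .
      also have "\<dots> = disagree (part_hash \<kappa> g m) (drop c u @ a # v) (drop c u @ v)"
        using cB by (simp add: x_def y_def)
      also have "\<dots> \<le> G + \<eta> + \<beta> * (1 + min 2 (length (drop c u) div B0))"
      proof (rule Suc.IH)
        show "set (drop c u @ a # v) \<subseteq> A" using Suc.prems(1) set_drop_subset[of c u] by auto
        have "sublist (drop c (u @ a # v)) (u @ a # v)" by (rule sublist_drop)
        then show "DR_periodic_free W R (drop c u @ a # v)"
          using DR_periodic_free_sublist[OF Suc.prems(2)] cB by simp
      qed
      also have "\<dots> \<le> G + \<eta> + \<beta> * (1 + min 2 ((e - B0) div B0))"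
        using cB B(1) \<beta> by (intro add_left_mono mult_left_mono) (auto simp: e_def intro!: min.mono div_le_mono diff_le_mono2 simp del: min.bounded_iff min_le_iff_disj)
      also have "\<dots> = M" using True B(1) by (simp add: M_def)
      finally show ?thesis by (simp add: disagree_def)
    qed
    then show ?thesis
      using prob_bind_pmf_le[of "marks A W \<rho>" "{}" "\<lambda>h. F (cut R W B h)" "{f. f x \<noteq> f y}" M] M_ge G \<eta>
      by simp
  next
    case after: False
    show ?thesis
    proof (cases "length y < B + R + W")
      case True
      \<comment> \<open>Since \<open>B\<close> is not in \<open>bad\<close>, \<open>x\<close> is too
        short as well; both strings are single blocks with nothing left over.\<close>
      then have short: "length x < B + R + W" using B(3) len by (auto simp: bad_def)
      have "disagree (F (cut R W B h)) x y \<le> G" for h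
      proof -
        have "disagree (F (cut R W B h)) x y \<le> disagree g x y + disagree (part_hash \<kappa> g m) [] []"
          unfolding F_def
          using disagree_xor_pmf_le[of g "part_hash \<kappa> g m" "\<lambda>x. take (cut R W B h x) x" "\<lambda>x. drop (cut R W B h x) x" x y]
            short True by (simp add: cut_def)
        also have "\<dots> \<le> G" using g[OF Suc.prems(1)] short B(2) by (simp add: x_def y_def)
        finally show ?thesis .
      qed
      then show ?thesis
        using prob_bind_pmf_le[of "marks A W \<rho>" "{}" "\<lambda>h. F (cut R W B h)" "{f. f x \<noteq> f y}" G] M_ge G \<eta>
        by (simp add: disagree_def)
    next
      case False
      let ?w = "\<lambda>i. window W (B + i) x"
      \<comment> \<open>The two ways to miss resynchronisation: the window seen only in
        \<open>x\<close> is marked, or no later candidate is.\<close>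
      define S where "S = {h. h (?w 0)} \<union> {h. \<forall>i\<in>{0<..<R}. \<not> h (?w i)}"
      have words: "?w i \<in> words A W" if "i < R" for i
        using that Suc.prems(1) False len by (intro window_in_words) (simp_all add: x_def)
      have "measure_pmf.prob (marks A W \<rho>) S
          \<le> measure_pmf.prob (marks A W \<rho>) {h. h (?w 0)}
            + measure_pmf.prob (marks A W \<rho>) {h. \<forall>i\<in>{0<..<R}. \<not> h (?w i)}"
        unfolding S_def by (rule measure_Un_le) auto
      also have "measure_pmf.prob (marks A W \<rho>) {h. h (?w 0)} = \<rho>"
        by (rule prob_marked[OF A \<rho> words[OF R]])
      also have "measure_pmf.prob (marks A W \<rho>) {h. \<forall>i\<in>{0<..<R}. \<not> h (?w i)} = (1 - \<rho>) ^ card {0<..<R}"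
      proof (rule prob_none_marked[OF A \<rho>])
        have "inj_on ?w {..<R}"
          using inj_on_window[of W R x B] Suc.prems(2) False len by (simp add: x_def)
        then show "inj_on ?w {0<..<R}" by (rule inj_on_subset) auto
        show "?w ` {0<..<R} \<subseteq> words A W" using words by auto
      qed
      finally have prob_S: "measure_pmf.prob (marks A W \<rho>) S \<le> \<eta>" by (simp add: \<eta>_def)
      have "measure_pmf.prob (F (cut R W B h)) {f. f x \<noteq> f y} \<le> G" if h: "h \<notin> S" for h
      proof -
        define c where "c = cut R W B h y"
        have c: "cut R W B h x = Suc c"
        proof -
          obtain i where "0 < i" "i < R" "h (?w i)" using h by (auto simp: S_def)
          moreover have "\<not> h (?w 0)" using h by (simp add: S_def)
          ultimately show ?thesis
            unfolding c_def x_def y_def using False after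
            by (intro cut_after_edit[of u B R W v h a i]) (simp_all add: x_def y_def e_def)
        qed
        have cB: "B \<le> c" "c \<le> B + R" using cut_bounds[of B R W y h] False by (simp_all add: c_def)
        have "e \<le> c" using cB(1) after by simp
        \<comment> \<open>The cuts fall at the same letter, so the remainders coincide and the first
          blocks differ by the deletion alone.\<close>
        have take: "take (Suc c) x = u @ a # take (c - e) v" "take c y = u @ take (c - e) v"
          and drop: "drop (Suc c) x = drop c y"
          using \<open>e \<le> c\<close> by (simp_all add: x_def y_def e_def Suc_diff_le)
        have "disagree (F (cut R W B h)) x y
            \<le> disagree g (take (Suc c) x) (take c y) + disagree (part_hash \<kappa> g m) (drop (Suc c) x) (drop c y)"
          unfolding F_def
          using disagree_xor_pmf_le[of g "part_hash \<kappa> g m" "\<lambda>x. take (cut R W B h x) x" "\<lambda>x. drop (cut R W B h x) x" x y]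
          unfolding c c_def[symmetric] .
        also have "\<dots> = disagree g (u @ a # take (c - e) v) (u @ take (c - e) v)"
          unfolding drop unfolding take by simp
        also have "\<dots> \<le> G"
        proof (rule g)
          show "set (u @ a # take (c - e) v) \<subseteq> A"
            using Suc.prems(1) set_take_subset[of "c - e" v] by auto
          have "length (u @ a # take (c - e) v) \<le> Suc c" by (simp add: take(1)[symmetric])
          then show "length (u @ a # take (c - e) v) \<le> 2 * B0 + R + W" using cB(2) B(2) by simp
        qed
        finally show ?thesis by (simp add: disagree_def)
      qed
      then have "measure_pmf.prob (bind_pmf (marks A W \<rho>) (\<lambda>h. F (cut R W B h))) {f. f x \<noteq> f y}
          \<le> G + measure_pmf.prob (marks A W \<rho>) S"
        using G by (intro prob_bind_pmf_le)
      then show ?thesis using prob_S M_ge by simp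
    qed
  qed
  have "disagree (part_hash \<kappa> g (Suc m)) x y
      = measure_pmf.prob (bind_pmf (pmf_of_set {B0..<2 * B0})
          (\<lambda>B. bind_pmf (marks A W \<rho>) (\<lambda>h. F (cut R W B h)))) {f. f x \<noteq> f y}"
    by (simp add: disagree_def F_def \<kappa>_def cuts_def bind_assoc_pmf bind_map_pmf)
  also have "\<dots> \<le> M + measure_pmf.prob (pmf_of_set {B0..<2 * B0}) bad"
    using inner B0(1) M_ge G \<eta> by (intro prob_bind_pmf_le) auto
  also have "\<dots> \<le> G + \<eta> + \<beta> * (1 + min 2 (e div B0))"
  \<comment> \<open>Below \<open>3 * B0\<close> the minimum is not yet active and one more chance
    \<open>\<beta>\<close> is paid. From there on \<open>B + R + W < 3 * B0\<close> rules out
    \<open>bad\<close>, and the minimum equals 2 both before and after the cut.\<close>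
  proof (cases "e < 3 * B0")
    case True
    have "measure_pmf.prob (pmf_of_set {B0..<2 * B0}) bad \<le> \<beta>"
      unfolding bad_def \<beta>_def by (rule prob_offset_hits_edit[OF B0(1)])
    moreover have "M + \<beta> = G + \<eta> + \<beta> * (1 + min 2 (e div B0))"
    proof (cases "e < B0")
      case False
      then have "e div B0 = Suc ((e - B0) div B0)" using B0(1) by (simp add: le_div_geq)
      moreover have "e div B0 \<le> 2" using True B0(1) by (simp add: less_Suc_eq_le[symmetric] div_less_iff_less_mult mult.commute)
      ultimately show ?thesis using False by (simp add: M_def algebra_simps)
    qed (simp add: M_def)
    ultimately show ?thesis by simp
  next
    case False
    have "{B0..<2 * B0} \<inter> bad = {}"
      using False B0(2) len by (auto simp: bad_def e_def y_def)
    then have "measure_pmf.prob (pmf_of_set {B0..<2 * B0}) bad = 0"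
      using B0(1) by (simp add: measure_pmf_of_set)
    moreover have "2 \<le> (e - B0) div B0"
      using False B0(1) by (simp add: less_eq_div_iff_mult_less_eq)
    moreover from this have "2 \<le> e div B0" using div_le_mono[of "e - B0" e B0] by linarith
    ultimately show ?thesis using False by (simp add: M_def min_absorb1)
  qed
  finally show ?case by (simp add: x_def y_def e_def)
qed

subsection \<open>The embedding\<close>

lemma p_periodic_sublist:
  assumes "p_periodic p w" "sublist v w"
  shows "p_periodic p v"
proof -
  obtain l r where w: "w = l @ v @ r" using assms(2) by (auto simp: sublist_def)
  have "v ! i = v ! (i + p)" if "i + p < length v" for i
  proof -
    have "w ! (length l + i) = w ! (length l + i + p)"
      using assms(1)[unfolded p_periodic_def, rule_format, of "length l + i"] that by (simp add: w)
    then show ?thesis using that by (simp add: w nth_append add.assoc)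
  qed
  then show ?thesis by (simp add: p_periodic_def)
qed

lemma DR_periodic_sublist:
  "DR_periodic D' R w \<Longrightarrow> sublist v w \<Longrightarrow> D \<le> length v \<Longrightarrow> DR_periodic D R v"
  unfolding DR_periodic_def using p_periodic_sublist by blast

text \<open>A substring of length at least \<open>2 * D\<close> has \<open>D\<close> or more letters
  on one side of the seam, and that piece inherits the period.\<close>

lemma DR_periodic_free_append:
  assumes x: "DR_periodic_free D R (x1 @ x2)" and y: "DR_periodic_free D R (y1 @ y2)"
  shows "DR_periodic_free (2 * D) R (y1 @ x2)"
  unfolding DR_periodic_free_def
proof
  assume "\<exists>v. sublist v (y1 @ x2) \<and> DR_periodic (2 * D) R v"
  then obtain v where v: "sublist v (y1 @ x2)" "DR_periodic (2 * D) R v" by blast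
  have "\<exists>v1 v2. v = v1 @ v2 \<and> sublist v1 y1 \<and> sublist v2 x2"
    using v(1)[unfolded sublist_append]
    by (metis append_Nil append_Nil2 prefix_imp_sublist sublist_Nil_left suffix_imp_sublist)
  then obtain v1 v2 where v12: "v = v1 @ v2" "sublist v1 y1" "sublist v2 x2" by blast
  have "D \<le> length v1 \<or> D \<le> length v2" using v(2) v12(1) by (auto simp: DR_periodic_def)
  then show False
  proof
    assume "D \<le> length v1"
    then have "DR_periodic D R v1" using DR_periodic_sublist[OF v(2)] v12(1) by simp
    moreover have "sublist v1 (y1 @ y2)" using v12(2) by (simp add: sublist_append)
    ultimately show False using y by (auto simp: DR_periodic_free_def)
  next
    assume "D \<le> length v2"
    then have "DR_periodic D R v2" using DR_periodic_sublist[OF v(2)] v12(1) by simp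
    moreover have "sublist v2 (x1 @ x2)" using v12(3) by (simp add: sublist_append)
    ultimately show False using x by (auto simp: DR_periodic_free_def)
  qed
qed

text \<open>A string of length \<open>D\<close> is vacuously \<open>D\<close>-periodic.\<close>

lemma DR_periodic_free_length_less:
  assumes "DR_periodic_free D D x" "1 \<le> D"
  shows "length x < D"
proof (rule ccontr)
  assume "\<not> length x < D"
  then have "DR_periodic D D (take D x)"
    using assms(2) by (auto simp: DR_periodic_def p_periodic_def intro!: exI[of _ D])
  then show False using assms(1) sublist_take by (auto simp: DR_periodic_free_def)
qed

section \<open>Hashing a single block\<close>

lemma set_pad: "set u \<subseteq> A \<Longrightarrow> z \<in> A \<Longrightarrow> length u \<le> N \<Longrightarrow> pad N z u \<in> words A N"
  by (auto simp: pad_def words_def)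

lemma card_threshold_diff:
  assumes "k \<le> N" "l \<le> N"
  shows "card {i. i < N \<and> (i < k) \<noteq> (i < l)} = nat \<bar>int k - int l\<bar>"
proof -
  have "{i. i < N \<and> (i < k) \<noteq> (i < l)} = {min k l..<max k l}" using assms by auto
  then show ?thesis unfolding max_def min_def by (cases "k \<le> l") auto
qed

text \<open>Padding makes short blocks embeddable, but it identifies blocks that differ only by trailing
  copies of \<open>z\<close>; the second factor restores this loss by hashing the block length in unary.\<close>

lemma exists_block_hash:
  fixes A :: "'a set" and \<psi> :: "'a list \<Rightarrow> 'b list" and t c :: real
  assumes A: "finite A" "z \<in> A" and emb: "hamming_embedding A N c \<psi>" and t: "0 \<le> t" and c: "0 \<le> c"
  obtains g where
    "\<And>u v. set u \<subseteq> A \<Longrightarrow> set v \<subseteq> A \<Longrightarrow> length u \<le> N \<Longrightarrow> length v \<le> N \<Longrightarrow>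
      0 \<le> bias g u v \<and> bias g u v \<le> exp (- t * real (edit_distance u v))"
    "\<And>u a v. set (u @ a # v) \<subseteq> A \<Longrightarrow> length (u @ a # v) \<le> N \<Longrightarrow>
      disagree g (u @ a # v) (u @ v) \<le> t * (2 * c + 1) / 2"
proof -
  from emb obtain m T where m: "\<And>x. x \<in> words A N \<Longrightarrow> length (\<psi> x) = m" and T: "1 \<le> T"
    and lo: "\<And>x y. x \<in> words A N \<Longrightarrow> y \<in> words A N \<Longrightarrow>
      real (edit_distance x y) \<le> 1 / T * real (hamming (\<psi> x) (\<psi> y))"
    and up: "\<And>x y. x \<in> words A N \<Longrightarrow> y \<in> words A N \<Longrightarrow>
      1 / T * real (hamming (\<psi> x) (\<psi> y)) \<le> c * real (edit_distance x y)"
    unfolding hamming_embedding_def by blast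
  define X where "X = {u. set u \<subseteq> A \<and> length u \<le> N}"
  have X: "finite X" unfolding X_def by (rule finite_lists_length_le[OF A(1)])
  \<comment> \<open>The rate \<open>exp (- t / T)\<close> cancels the scaling of the embedding: the
    exponent becomes \<open>t\<close> times the normalized Hamming distance.\<close>
  have "\<exists>g. \<forall>u\<in>X. \<forall>v\<in>X. bias g u v
      = exp (- t / T) ^ card {i. i < m \<and> \<psi> (pad N z u) ! i \<noteq> \<psi> (pad N z v) ! i}"
    by (rule exists_sampling_hash[OF X]) (use t T in simp_all)
  then obtain g1 where g1: "\<And>u v. u \<in> X \<Longrightarrow> v \<in> X \<Longrightarrow> bias g1 u v
      = exp (- t / T) ^ card {i. i < m \<and> \<psi> (pad N z u) ! i \<noteq> \<psi> (pad N z v) ! i}" by blast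
  have "\<exists>g. \<forall>u\<in>X. \<forall>v\<in>X. bias g u v = exp (- t) ^ card {i. i < N \<and> (i < length u) \<noteq> (i < length v)}"
    by (rule exists_sampling_hash[OF X]) (use t in simp_all)
  then obtain g2 where g2: "\<And>u v. u \<in> X \<Longrightarrow> v \<in> X \<Longrightarrow>
      bias g2 u v = exp (- t) ^ card {i. i < N \<and> (i < length u) \<noteq> (i < length v)}" by blast
  define g where "g = xor_pmf g1 g2 (\<lambda>u. u) (\<lambda>u. u)"
  define H where "H u v = 1 / T * real (hamming (\<psi> (pad N z u)) (\<psi> (pad N z v)))" for u v
  define d where "d u v = nat \<bar>int (length u) - int (length v)\<bar>" for u v :: "'a list"
  have bias: "bias g u v = exp (- t * (H u v + real (d u v)))" if "u \<in> X" "v \<in> X" for u v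
  proof -
    have "length (\<psi> (pad N z u)) = m"
      by (rule m, rule set_pad) (use that A(2) in \<open>simp_all add: X_def\<close>)
    then have "bias g1 u v = exp (- t / T) ^ hamming (\<psi> (pad N z u)) (\<psi> (pad N z v))"
      using g1[OF that] by (simp add: hamming_def)
    also have "\<dots> = exp (- t * H u v)"
      by (simp add: H_def mult.commute flip: exp_of_nat_mult)
    finally have 1: "bias g1 u v = exp (- t * H u v)" .
    have "bias g2 u v = exp (- t) ^ d u v"
      using g2[OF that] that card_threshold_diff[of "length u" N "length v"] by (simp add: X_def d_def)
    also have "\<dots> = exp (- t * real (d u v))"
      by (simp add: mult.commute flip: exp_of_nat_mult)
    finally show ?thesis
      by (simp add: g_def bias_xor_pmf 1 algebra_simps flip: exp_add)
  qed
  show thesis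
  proof (rule that[of g])
    fix u v assume uv: "set u \<subseteq> A" "set v \<subseteq> A" "length u \<le> N" "length v \<le> N"
    have "real (edit_distance u v) \<le> real (edit_distance (pad N z u) (pad N z v)) + real (d u v)"
      using edit_distance_pad[OF uv(3,4), of z] unfolding d_def by linarith
    also have "\<dots> \<le> H u v + real (d u v)"
      using lo[OF set_pad set_pad] uv A(2) by (simp add: H_def)
    finally have "t * real (edit_distance u v) \<le> t * (H u v + real (d u v))"
      by (rule mult_left_mono[OF _ t])
    then show "0 \<le> bias g u v \<and> bias g u v \<le> exp (- t * real (edit_distance u v))"
      using bias[of u v] uv by (simp add: X_def)
  next
    fix u a v assume uv: "set (u @ a # v) \<subseteq> A" "length (u @ a # v) \<le> N"
    let ?x = "u @ a # v" and ?y = "u @ v"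
    have y: "set ?y \<subseteq> A" "length ?y \<le> N" using uv by auto
    have "H ?x ?y \<le> c * real (edit_distance (pad N z ?x) (pad N z ?y))"
      unfolding H_def by (rule up[OF set_pad[OF uv(1) A(2) uv(2)] set_pad[OF y(1) A(2) y(2)]])
    also have "\<dots> \<le> c * 2"
      using edit_distance_pad_deletion[OF uv(2), of z] c by (intro mult_left_mono) simp_all
    \<comment> \<open>Padded distance at most 2 gives \<open>2 * c\<close>; the length difference
      gives 1.\<close>
    finally have "t * (H ?x ?y + real (d ?x ?y)) \<le> t * (2 * c + 1)"
      using t by (intro mult_left_mono) (simp_all add: d_def)
    moreover have "1 - t * (H ?x ?y + real (d ?x ?y)) \<le> bias g ?x ?y"
      using bias[of ?x ?y] uv y exp_ge_add_one_self[of "- t * (H ?x ?y + real (d ?x ?y))"]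
      by (simp add: X_def)
    ultimately show "disagree g ?x ?y \<le> t * (2 * c + 1) / 2"
      unfolding bias_def by linarith
  qed
qed

text \<open>Since \<open>k \<le> K\<close>, the exponent stays in [0,1], where
  \<open>1 - exp (- s)\<close> is at least \<open>s / 2\<close>. The second factor 1/2 comes from
  passing from bias to probability.\<close>

lemma disagree_lower_bound:
  assumes bias: "bias \<alpha> x y \<le> exp (- (1 / (c * real K)) * real k)"
    and k: "k \<le> K" "1 \<le> K" and c: "1 \<le> c"
  shows "1 / c * (1 / 4 * real k) \<le> real K * disagree \<alpha> x y"
proof -
  define s where "s = real k / (c * real K)"
  have "real k \<le> c * real K" using k c mult_mono[of 1 c "real k" "real K"] by simp
  then have s: "0 \<le> s" "s \<le> 1" using k c by (simp_all add: s_def)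
  have "exp (- s) \<le> 1 / (1 + s)"
    using exp_ge_add_one_self[of s] s by (simp add: exp_minus inverse_eq_divide frac_le)
  also have "\<dots> \<le> 1 - s / 2"
    using s mult_left_mono[of s 1 s] by (simp add: field_simps)
  finally have "s / 4 \<le> disagree \<alpha> x y"
    using bias by (simp add: bias_def s_def)
  then have "real K * (s / 4) \<le> real K * disagree \<alpha> x y" by (intro mult_left_mono) simp_all
  then show ?thesis using k c by (simp add: s_def field_simps)
qed

text \<open>By Bernoulli \<open>(1 + 1/K) ^ (K^2 - 1)\<close> is at least \<open>K\<close>, and its
  product with the left-hand side is a power of \<open>1 - 1/K^2\<close>, hence at most 1.\<close>

lemma none_marked_bound:
  assumes "1 \<le> K"
  shows "(1 - 1 / real K) ^ (K ^ 2 - 1) \<le> 1 / real K"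
proof -
  let ?r = "1 / real K" and ?n = "K ^ 2 - 1"
  have n: "real ?n = real K ^ 2 - 1" using assms by (simp add: of_nat_diff)
  have "real K \<le> 1 + real ?n * ?r" using assms by (simp add: n field_simps power2_eq_square)
  also have "\<dots> \<le> (1 + ?r) ^ ?n" by (rule Bernoulli_inequality) (rule order_trans[of _ 0], simp_all)
  finally have K: "real K \<le> (1 + ?r) ^ ?n" .
  have "(1 - ?r) ^ ?n * (1 + ?r) ^ ?n = (1 - ?r ^ 2) ^ ?n"
    by (simp add: power_mult_distrib[symmetric] algebra_simps power2_eq_square)
  also have "\<dots> \<le> 1" using assms by (intro power_le_one) (simp_all add: power_le_one)
  finally have "(1 - ?r) ^ ?n * (1 + ?r) ^ ?n \<le> 1" .
  moreover have "(1 - ?r) ^ ?n * real K \<le> (1 - ?r) ^ ?n * (1 + ?r) ^ ?n"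
    using K assms by (intro mult_left_mono) simp_all
  ultimately have "(1 - ?r) ^ ?n * real K \<le> 1" by (rule order_trans[rotated])
  then show ?thesis using assms by (subst pos_le_divide_eq) simp_all
qed

text \<open>If \<open>D \<le> K ^ 2\<close>, then \<open>R = D\<close> forces both strings to be
  shorter than \<open>D\<close>, and one block hash suffices. Otherwise \<open>R = K ^ 2\<close>,
  and the strings are cut into blocks.\<close>

lemma exists_embedding:
  fixes A :: "'a set" and \<psi> :: "'a list \<Rightarrow> 'b list" and c :: real and n K D :: nat
  assumes A: "finite A" and c: "2 \<le> c" and emb: "hamming_embedding A (12 * K ^ 3 * D) c \<psi>"
    and D: "1 \<le> D" and K: "1 \<le> K"
  defines "R \<equiv> min (K ^ 2) D"
  shows "\<exists>\<alpha>. \<forall>x\<in>words A n. \<forall>y\<in>words A n. DR_periodic_free D R x \<longrightarrow> DR_periodic_free D R y \<longrightarrow>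
    edit_distance x y \<le> K \<longrightarrow>
      1 / c * (1 / 4 * real (edit_distance x y)) \<le> real K * disagree \<alpha> x y \<and>
      real K * disagree \<alpha> x y \<le> 14 * real (edit_distance x y)"
proof (cases "A = {}")
  case True
  then show ?thesis by (auto simp: words_def)
next
  case False
  then obtain z where z: "z \<in> A" by blast
  \<comment> \<open>\<open>N\<close> bounds the length of every block; the rate \<open>t\<close>
    keeps the effect of one deletion on a block hash below \<open>2 / K\<close>.\<close>
  define N t where "N = 12 * K ^ 3 * D" and "t = 1 / (c * real K)"
  have t: "0 \<le> t" using c by (simp add: t_def)
  obtain g where
    g: "\<And>u v. set u \<subseteq> A \<Longrightarrow> set v \<subseteq> A \<Longrightarrow> length u \<le> N \<Longrightarrow> length v \<le> N \<Longrightarrow>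
      0 \<le> bias g u v \<and> bias g u v \<le> exp (- t * real (edit_distance u v))" and
    g_del: "\<And>u a v. set (u @ a # v) \<subseteq> A \<Longrightarrow> length (u @ a # v) \<le> N \<Longrightarrow>
      disagree g (u @ a # v) (u @ v) \<le> t * (2 * c + 1) / 2"
    using exists_block_hash[OF A z emb[folded N_def] t] c by auto
  have "t * (2 * c + 1) / 2 \<le> 2 / real K"
    using c K by (simp add: t_def field_simps)
  then have g_del: "disagree g (u @ a # v) (u @ v) \<le> 2 / real K"
    if "set (u @ a # v) \<subseteq> A" "length (u @ a # v) \<le> N" for u a v
    using g_del[OF that] by linarith
  have upper: "real K * disagree \<alpha> x y \<le> 14 * real (edit_distance x y)"
    if del: "\<And>u a v. good (u @ a # v) \<Longrightarrow> good (u @ v) \<Longrightarrow> disagree \<alpha> (u @ a # v) (u @ v) \<le> 7 / real K"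
      and good: "\<And>y1 y2 x1 x2. y = y1 @ y2 \<Longrightarrow> x = x1 @ x2 \<Longrightarrow> good (y1 @ x2)"
    for \<alpha> :: "('a list \<Rightarrow> bool) pmf" and x y good
  proof -
    have "disagree \<alpha> x y \<le> 2 * real (edit_distance x y) * (7 / real K)"
      by (rule pseudometric_le_edit_distance[where good = good, OF disagree_self disagree_commute disagree_triangle _ del good]) simp_all
    then show ?thesis using K by (simp add: field_simps)
  qed
  have K_pow: "K * D \<le> K ^ 3 * D" "D \<le> K ^ 3 * D"
    using K by (simp_all add: self_le_power)
  show ?thesis
  proof (cases "D \<le> K ^ 2")
    case True
    then have R: "R = D" by (simp add: R_def)
    have "1 / c * (1 / 4 * real (edit_distance x y)) \<le> real K * disagree g x y \<and>
      real K * disagree g x y \<le> 14 * real (edit_distance x y)"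
      if xy: "x \<in> words A n" "y \<in> words A n" "DR_periodic_free D R x" "DR_periodic_free D R y"
        "edit_distance x y \<le> K" for x y
    proof
      have len: "length x < D" "length y < D"
        using DR_periodic_free_length_less D xy(3,4) unfolding R by auto
      have sets: "set x \<subseteq> A" "set y \<subseteq> A" using xy(1,2) by (simp_all add: words_def)
      \<comment> \<open>A prefix of \<open>y\<close> followed by a suffix of \<open>x\<close> has
        fewer than \<open>2 * D\<close> letters.\<close>
      have N: "2 * D \<le> N" using K_pow(2) by (simp add: N_def)
      have "bias g x y \<le> exp (- (1 / (c * real K)) * real (edit_distance x y))"
        using g[OF sets] len N unfolding t_def by simp
      then show "1 / c * (1 / 4 * real (edit_distance x y)) \<le> real K * disagree g x y"
        by (rule disagree_lower_bound[OF _ xy(5) K]) (use c in simp)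
      show "real K * disagree g x y \<le> 14 * real (edit_distance x y)"
      proof (rule upper[where good = "\<lambda>w. set w \<subseteq> A \<and> length w \<le> N"])
        fix u v :: "'a list" and a
        assume "set (u @ a # v) \<subseteq> A \<and> length (u @ a # v) \<le> N"
        then have "disagree g (u @ a # v) (u @ v) \<le> 2 / real K" using g_del by blast
        also have "\<dots> \<le> 7 / real K" by (rule divide_right_mono) simp_all
        finally show "disagree g (u @ a # v) (u @ v) \<le> 7 / real K" .
      next
        fix y1 y2 x1 x2 assume "y = y1 @ y2" "x = x1 @ x2"
        then show "set (y1 @ x2) \<subseteq> A \<and> length (y1 @ x2) \<le> N" using sets len N by auto
      qed
    qed
    then show ?thesis by blast
  next
    case False
    then have R: "R = K ^ 2" by (simp add: R_def)
    \<comment> \<open>The windows have length \<open>2 * D\<close> because hybrid strings are free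
      only of periodic substrings that long; \<open>B0\<close> makes the chance of hitting the edit
      exactly \<open>1 / K\<close>.\<close>
    define W B0 \<rho> where "W = 2 * D" and "B0 = K * (R + W + 1)" and "\<rho> = 1 / real K"
    have B0: "0 < B0" "R + W \<le> B0" using K mult_le_mono1[of 1 K "R + W"] by (simp_all add: B0_def algebra_simps)
    have "B0 \<le> K * (3 * D)" unfolding B0_def using False by (intro mult_le_mono2) (simp add: R W_def)
    also have "\<dots> = 3 * (K * D)" by simp
    also have "\<dots> \<le> 3 * (K ^ 3 * D)" by (rule mult_le_mono2[OF K_pow(1)])
    finally have "B0 \<le> 3 * (K ^ 3 * D)" .
    then have N: "2 * B0 + R + W \<le> N"
      using K_pow(2) False unfolding N_def R W_def by linarith
    have \<rho>: "0 \<le> \<rho>" "\<rho> \<le> 1" using K by (simp_all add: \<rho>_def)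
    define \<kappa> where "\<kappa> = cuts A R W \<rho> B0"
    let ?\<alpha> = "part_hash \<kappa> g n"
    have \<beta>: "real (R + W + 1) / real B0 = 1 / real K"
      unfolding B0_def of_nat_mult by (rule nonzero_divide_mult_cancel_right) simp
    have \<eta>: "\<rho> + (1 - \<rho>) ^ (R - 1) \<le> 2 / real K"
      using none_marked_bound[OF K] by (simp add: \<rho>_def R)
    have del: "disagree ?\<alpha> (u @ a # v) (u @ v) \<le> 7 / real K"
      if "set (u @ a # v) \<subseteq> A" "DR_periodic_free W R (u @ a # v)" for u a v
    proof -
      have "disagree ?\<alpha> (u @ a # v) (u @ v)
          \<le> 2 / real K + (\<rho> + (1 - \<rho>) ^ (R - 1))
            + real (R + W + 1) / real B0 * (1 + min 2 (length u div B0))"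
        unfolding \<kappa>_def using that g_del N K
        by (intro disagree_part_hash_deletion[OF A \<rho> B0]) (simp_all add: R)
      \<comment> \<open>The 7 consists of 2 for the block hash, 2 for failed resynchronisation and 3
        for the chances of meeting the edit; substitutions double it to 14.\<close>
      also have "\<dots> \<le> 2 / real K + 2 / real K + 1 / real K * 3"
        unfolding \<beta> using \<eta> by (intro add_mono mult_left_mono) simp_all
      finally show ?thesis by simp
    qed
    have "1 / c * (1 / 4 * real (edit_distance x y)) \<le> real K * disagree ?\<alpha> x y \<and>
      real K * disagree ?\<alpha> x y \<le> 14 * real (edit_distance x y)"
      if xy: "x \<in> words A n" "y \<in> words A n" "DR_periodic_free D R x" "DR_periodic_free D R y"
        "edit_distance x y \<le> K" for x y
    proof
      have sets: "set x \<subseteq> A" "set y \<subseteq> A" and len: "length x \<le> n" "length y \<le> n"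
        using xy(1,2) by (simp_all add: words_def)
      have "bias ?\<alpha> x y \<le> exp (- t * real (edit_distance x y))"
      proof (rule bias_part_hash_le[OF t g _ _ sets len])
        show "length (take (c x) x) \<le> N" if "c \<in> set_pmf \<kappa>" for c and x :: "'a list"
          using length_take_cuts[OF that[unfolded \<kappa>_def] B0(1), of x] N by linarith
        show "0 < c x" if "c \<in> set_pmf \<kappa>" "x \<noteq> []" for c and x :: "'a list"
          by (rule cuts_pos[OF that(1)[unfolded \<kappa>_def] B0(1) that(2)])
      qed
      then show "1 / c * (1 / 4 * real (edit_distance x y)) \<le> real K * disagree ?\<alpha> x y"
        unfolding t_def by (rule disagree_lower_bound[OF _ xy(5) K]) (use c in simp)
      show "real K * disagree ?\<alpha> x y \<le> 14 * real (edit_distance x y)"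
      proof (rule upper[where good = "\<lambda>w. set w \<subseteq> A \<and> DR_periodic_free W R w"])
        show "disagree ?\<alpha> (u @ a # v) (u @ v) \<le> 7 / real K"
          if "set (u @ a # v) \<subseteq> A \<and> DR_periodic_free W R (u @ a # v)" for u a v
          using that by (intro del) simp_all
        fix y1 y2 x1 x2 assume "y = y1 @ y2" "x = x1 @ x2"
        then show "set (y1 @ x2) \<subseteq> A \<and> DR_periodic_free W R (y1 @ x2)"
          using sets DR_periodic_free_append[of D R x1 x2 y1 y2] xy(3,4) by (simp add: W_def)
      qed
    qed
    then show ?thesis by blast
  qed
qed

text \<open>The constants come before all other quantifiers, so they are uniform in the alphabet,
  \<open>\<gamma>\<close>, \<open>\<psi>\<close> and \<open>D\<close>; \<open>R\<close> is fixed
  before \<open>n\<close>. The argument of \<open>\<gamma>\<close> is exactly the padded block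
  length.\<close>

theorem theorem21:
  "\<exists>(cR :: real) (cN :: nat) (cL :: real) (cU :: real).
    cR > 0 \<and> cN > 0 \<and> cL > 0 \<and> cU > 0 \<and>
    (\<forall>(A :: 'a set) (\<gamma> :: nat \<Rightarrow> real) (\<psi> :: nat \<Rightarrow> 'a list \<Rightarrow> 'b list) (D :: nat \<Rightarrow> nat).
       finite A \<longrightarrow>
       (\<forall>n. \<gamma> n \<ge> 2) \<longrightarrow> subpolynomial \<gamma> \<longrightarrow>
       (\<forall>n. hamming_embedding A n (\<gamma> n) (\<psi> n)) \<longrightarrow>
       poly_bounded D \<longrightarrow> (\<forall>K\<ge>1. D K \<ge> 1) \<longrightarrow>
       (\<forall>K. \<exists>R :: nat.
          real R \<le> cR * real K ^ 3 \<and> R \<le> D K \<and>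
          (\<forall>n. \<exists>\<alpha> :: ('a list \<Rightarrow> bool) pmf.
             \<forall>x\<in>words A n. \<forall>y\<in>words A n.
               DR_periodic_free (D K) R x \<longrightarrow> DR_periodic_free (D K) R y \<longrightarrow>
               edit_distance x y \<le> K \<longrightarrow>
               1 / \<gamma> (cN * K ^ 3 * D K) * (cL * real (edit_distance x y))
                 \<le> real K * measure_pmf.prob \<alpha> {f. f x \<noteq> f y} \<and>
               real K * measure_pmf.prob \<alpha> {f. f x \<noteq> f y}
                 \<le> cU * real (edit_distance x y))))"
proof (rule exI[of _ 1], rule exI[of _ 12], rule exI[of _ "1 / 4"], rule exI[of _ 14],
    intro conjI allI impI)
  fix A :: "'a set" and \<gamma> and \<psi> :: "nat \<Rightarrow> 'a list \<Rightarrow> 'b list" and D :: "nat \<Rightarrow> nat" and K :: nat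
  assume A: "finite A" and \<gamma>: "\<forall>n. 2 \<le> \<gamma> n" and emb: "\<forall>n. hamming_embedding A n (\<gamma> n) (\<psi> n)"
    and D: "\<forall>K\<ge>1. 1 \<le> D K"
  show "\<exists>R. real R \<le> 1 * real K ^ 3 \<and> R \<le> D K \<and>
      (\<forall>n. \<exists>\<alpha> :: ('a list \<Rightarrow> bool) pmf. \<forall>x\<in>words A n. \<forall>y\<in>words A n.
        DR_periodic_free (D K) R x \<longrightarrow> DR_periodic_free (D K) R y \<longrightarrow> edit_distance x y \<le> K \<longrightarrow>
        1 / \<gamma> (12 * K ^ 3 * D K) * (1 / 4 * real (edit_distance x y))
          \<le> real K * measure_pmf.prob \<alpha> {f. f x \<noteq> f y} \<and>
        real K * measure_pmf.prob \<alpha> {f. f x \<noteq> f y} \<le> 14 * real (edit_distance x y))"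
  proof (intro exI[of _ "min (K ^ 2) (D K)"] conjI allI)
    have "K ^ 2 \<le> K ^ 3"
      by (cases "K = 0") (auto intro!: power_increasing)
    then have "min (K ^ 2) (D K) \<le> K ^ 3"
      by (rule order_trans[OF min.cobounded1])
    then show "real (min (K ^ 2) (D K)) \<le> 1 * real K ^ 3"
      by (metis mult_1 of_nat_mono of_nat_power)
    fix n
    show "\<exists>\<alpha> :: ('a list \<Rightarrow> bool) pmf. \<forall>x\<in>words A n. \<forall>y\<in>words A n.
        DR_periodic_free (D K) (min (K ^ 2) (D K)) x \<longrightarrow>
        DR_periodic_free (D K) (min (K ^ 2) (D K)) y \<longrightarrow> edit_distance x y \<le> K \<longrightarrow>
        1 / \<gamma> (12 * K ^ 3 * D K) * (1 / 4 * real (edit_distance x y))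
          \<le> real K * measure_pmf.prob \<alpha> {f. f x \<noteq> f y} \<and>
        real K * measure_pmf.prob \<alpha> {f. f x \<noteq> f y} \<le> 14 * real (edit_distance x y)"
    \<comment> \<open>For \<open>K = 0\<close> the distance is 0 and all three terms vanish.\<close>
    proof (cases "K = 0")
      case False
      then have K: "1 \<le> K" by simp
      show ?thesis
        using exists_embedding[OF A \<gamma>[rule_format] emb[rule_format] D[rule_format, OF K] K, of n]
        unfolding disagree_def .
    qed simp
  qed simp
qed simp_all

end
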